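(* For every integer $n>1$, $A(2^n+1)=2^n+2$.
   Context: Let $\theta$ be the Thue--Morse substitution on the alphabet $\{0,1\}$, $\theta\colon 0\mapsto 01,\ 1\mapsto 10$ (extended to words by concatenation), and let $v=v_0v_1v_2\dots=\lim_{n\to\infty}\theta^n(0)\in\{0,1\}^{\mathbb{N}}$ be the Thue--Morse word, indexed from $0$. For positive integers $d,L$, a monochromatic arithmetic progression of difference $d$ and length $L$ in $v$ means that there is $i\ge 0$ with $v_i=v_{i+d}=v_{i+2d}=\dots=v_{i+(L-1)d}$. For a positive integer $d$, $A(d)$ denotes the maximum length $L$ of a monochromatic arithmetic progression of difference $d$ in $v$ (this maximum exists and is finite for every $d$). *)

theory Defs
  imports Complex_Main "HOL-Library.Z2"
begin

definition subst_letter :: "bit \<Rightarrow> bit list" where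
  "subst_letter a = (if a = 0 then [0, 1] else [1, 0])"

definition subst :: "bit list \<Rightarrow> bit list" where
  "subst w = concat (map subst_letter w)"

text \<open>
  The limit of the words \<open>(subst ^^ n) [0]\<close> is taken letter by letter: the \<open>k\<close>-th letter is the
  one eventually found at position \<open>k\<close> of these words. Lemma \<open>thue_morse_limit\<close> below shows that
  this limit exists.
\<close>

definition thue_morse :: "nat \<Rightarrow> bit" where
  "thue_morse k = (THE a. \<forall>\<^sub>F n in sequentially.
     k < length ((subst ^^ n) [0]) \<and> (subst ^^ n) [0] ! k = a)"

definition has_mono_AP :: "nat \<Rightarrow> nat \<Rightarrow> bool" where
  "has_mono_AP d L \<longleftrightarrow> 0 < d \<and> 0 < L \<and>
     (\<exists>i. \<forall>j<L. thue_morse (i + j * d) = thue_morse i)"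

text \<open>
  \<open>GREATEST\<close> is unspecified if there is no maximal length.
\<close>

definition A :: "nat \<Rightarrow> nat" where
  "A d = (GREATEST L. has_mono_AP d L)"

lemma subst_append: "subst (u @ w) = subst u @ subst w"
  by (simp add: subst_def)

lemma subst_funpow_append: "(subst ^^ n) (u @ w) = (subst ^^ n) u @ (subst ^^ n) w"
  by (induction n) (simp_all add: subst_append)

lemma length_subst: "length (subst w) = 2 * length w"
  by (induction w) (simp_all add: subst_def subst_letter_def)

lemma length_subst_funpow: "length ((subst ^^ n) w) = 2 ^ n * length w"
  by (induction n) (simp_all add: length_subst)

lemma subst_funpow_Suc: "(subst ^^ Suc n) [0] = (subst ^^ n) [0] @ (subst ^^ n) [1]"
proof -
  have "subst [0] = [0] @ [1]"
    by (simp add: subst_def subst_letter_def)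
  then show ?thesis
    by (simp only: funpow_Suc_right o_apply subst_funpow_append)
qed

lemma subst_funpow_nth_stable:
  assumes "k < 2 ^ m" "m \<le> n"
  shows "(subst ^^ n) [0] ! k = (subst ^^ m) [0] ! k"
  using assms(2)
proof (induction n rule: dec_induct)
  case (step n)
  have "k < 2 ^ n"
    using assms(1) step.hyps(1) by (meson less_le_trans one_le_numeral power_increasing)
  then show ?case
    unfolding subst_funpow_Suc using step.IH by (simp add: nth_append length_subst_funpow)
qed simp

lemma thue_morse_limit:
  "\<forall>\<^sub>F n in sequentially.
     k < length ((subst ^^ n) [0]) \<and> (subst ^^ n) [0] ! k = thue_morse k"
proof -
  let ?P = "\<lambda>a. \<forall>\<^sub>F n in sequentially.
     k < length ((subst ^^ n) [0]) \<and> (subst ^^ n) [0] ! k = a"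
  have lt: "k < 2 ^ k"
    by (rule less_exp)
  have ex: "?P ((subst ^^ k) [0] ! k)"
    unfolding eventually_sequentially
  proof (intro exI allI impI conjI)
    fix n assume "k \<le> n"
    then show "(subst ^^ n) [0] ! k = (subst ^^ k) [0] ! k"
      by (rule subst_funpow_nth_stable[OF lt])
    have "k < 2 ^ n"
      using lt \<open>k \<le> n\<close> by (meson less_le_trans one_le_numeral power_increasing)
    then show "k < length ((subst ^^ n) [0])"
      by (simp add: length_subst_funpow)
  qed
  have unique: "a = b" if "?P a" "?P b" for a b
  proof -
    have "\<forall>\<^sub>F n in sequentially. a = b"
      using that by eventually_elim auto
    then show ?thesis
      by simp
  qed
  show ?thesis
    unfolding thue_morse_def by (rule theI[where P = ?P, OF ex]) (rule unique[OF _ ex])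
qed

end

theory Submission
  imports Defs
begin

text \<open>
  Put \<open>N = 2 ^ n\<close>. Since \<open>i + j (N + 1) = N (b + j) + (a + j)\<close> for \<open>i = N b + a\<close>, a progression of
  difference \<open>N + 1\<close> is monochromatic iff \<open>t (b + j) + t (a + j)\<close> is constant while \<open>a + j < N\<close>,
  and similarly after each carry, where the index in the upper digits jumps by one. So, up to
  complementation, the word contains the suffix \<open>t\<^sub>a \<dots> t\<^sub>N\<^sub>-\<^sub>1\<close> immediately before some position
  \<open>e\<close> and a prefix of \<open>t\<close> immediately after it. Equal neighbours only occur at
  positions \<open>2 k + 1, 2 k + 2\<close>. In a progression of length \<open>N + 3\<close>, the factor \<open>t\<^sub>1 t\<^sub>2 = 11\<close> of the
  prefix forces \<open>e\<close> to be odd, and \<open>t\<^sub>N\<^sub>-\<^sub>3 = t\<^sub>N\<^sub>-\<^sub>2\<close> forces it to be even unless the suffix has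
  at most two letters. In that case the same parity argument is applied after undoing the
  substitution once, at position \<open>(e + 1) / 2\<close>.
  A progression of length \<open>N + 2\<close> starts at \<open>4 N\<^sup>2 - (N + 1)\<close>, since \<open>t\<^sub>3 t\<^sub>4 t\<^sub>5 = 010\<close>.
\<close>

section \<open>Recursion for the Thue--Morse word\<close>

lemma nth_subst:
  assumes "k < length w"
  shows "subst w ! (2 * k) = w ! k" "subst w ! Suc (2 * k) = w ! k + 1"
proof -
  have "subst w ! (2 * k) = w ! k \<and> subst w ! Suc (2 * k) = w ! k + 1"
    using assms
  proof (induction w arbitrary: k)
    case (Cons x w)
    have *: "subst (x # w) = x # (x + 1) # subst w"
      by (simp add: subst_def subst_letter_def)
    show ?case
      using Cons by (cases k) (simp_all add: *)
  qed simp
  then show "subst w ! (2 * k) = w ! k" "subst w ! Suc (2 * k) = w ! k + 1"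
    by simp_all
qed

lemma thue_morse_eq_nth:
  assumes "k < 2 ^ m"
  shows "thue_morse k = (subst ^^ m) [0] ! k"
proof -
  obtain M where M: "\<And>n. n \<ge> M \<Longrightarrow> (subst ^^ n) [0] ! k = thue_morse k"
    using thue_morse_limit[of k] unfolding eventually_sequentially by blast
  show ?thesis
    using M[of "max M m"] subst_funpow_nth_stable[OF assms, of "max M m"] by simp
qed

lemma thue_morse_double: "thue_morse (2 * k) = thue_morse k"
  and thue_morse_Suc_double: "thue_morse (Suc (2 * k)) = thue_morse k + 1"
proof -
  have "k < 2 ^ k"
    by (rule less_exp)
  then have "2 * k < 2 ^ Suc k" "Suc (2 * k) < 2 ^ Suc k"
    unfolding power_Suc by linarith+
  with \<open>k < 2 ^ k\<close> show "thue_morse (2 * k) = thue_morse k"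
    "thue_morse (Suc (2 * k)) = thue_morse k + 1"
    by (simp_all only: thue_morse_eq_nth funpow.simps o_apply)
       (simp_all add: nth_subst length_subst_funpow)
qed

lemma thue_morse_0: "thue_morse 0 = 0"
  using thue_morse_eq_nth[of 0 0] by simp

lemma thue_morse_small:
  "thue_morse (Suc 0) = 1" "thue_morse 2 = 1" "thue_morse 3 = 0"
  "thue_morse 4 = 1" "thue_morse 5 = 0"
  using thue_morse_Suc_double[of 0] thue_morse_double[of 1] thue_morse_Suc_double[of 1]
    thue_morse_double[of 2] thue_morse_Suc_double[of 2]
  by (simp_all add: thue_morse_0 eval_nat_numeral)

text \<open>The word records the parity of the binary digit sum, so it is additive over splitting
  off low digits; the induction removes the lowest digit of \<open>a\<close>.\<close>

lemma thue_morse_digits: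
  assumes "a < 2 ^ n"
  shows "thue_morse (2 ^ n * b + a) = thue_morse b + thue_morse a"
  using assms
proof (induction n arbitrary: a)
  case 0
  then show ?case
    by (simp add: thue_morse_0)
next
  case (Suc n)
  define c where "c = a div 2"
  have "a = 2 * c \<or> a = Suc (2 * c)"
    unfolding c_def by presburger
  moreover from this Suc.prems have "c < 2 ^ n"
    by auto
  moreover have "2 ^ Suc n * b + 2 * c = 2 * (2 ^ n * b + c)"
    "2 ^ Suc n * b + Suc (2 * c) = Suc (2 * (2 ^ n * b + c))"
    by simp_all
  ultimately show ?case
    using Suc.IH[of c] by (metis thue_morse_double thue_morse_Suc_double add.assoc)
qed

text \<open>The letters at \<open>2 * k\<close> and \<open>Suc (2 * k)\<close> form the image of a
  single letter, so they differ.\<close>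

lemma thue_morse_eq_SucD:
  assumes "thue_morse m = thue_morse (Suc m)"
  shows "odd m"
proof
  assume "even m"
  then obtain k where "m = 2 * k"
    by (elim evenE)
  with assms have "thue_morse k = thue_morse k + 1"
    by (simp only: thue_morse_double thue_morse_Suc_double)
  then show False
    by (cases "thue_morse k") simp_all
qed

lemma thue_morse_neighbours:
  assumes "thue_morse m + p = c" "thue_morse (Suc m) + p = c"
  shows "odd m"
  using assms by (metis add_right_imp_eq thue_morse_eq_SucD)

lemma thue_morse_neighbours_double:
  assumes "thue_morse (2 * m) + p = c" "thue_morse (2 * Suc m) + p = c"
  shows "odd m"
  using assms unfolding thue_morse_double by (rule thue_morse_neighbours)

text \<open>Undoes the substitution across a block boundary: the complement at the odd position
  absorbs the extra \<open>1\<close>.\<close>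

lemma thue_morse_neighbours_Suc_double:
  assumes "thue_morse (Suc (2 * m)) + p = c" "thue_morse (2 * Suc m) + (p + 1) = c"
  shows "odd m"
  using assms unfolding thue_morse_double thue_morse_Suc_double
  by (intro thue_morse_neighbours[of m "p + 1" c]) (simp_all only: ac_simps)

text \<open>The first \<open>2 ^ n\<close> letters end in a full block 0110 or 1001.\<close>

lemma thue_morse_power_end:
  assumes "1 < n"
  shows "thue_morse (2 ^ n - 3) = thue_morse (2 ^ n - 2)"
    and "thue_morse (2 ^ n - 1) = thue_morse (2 ^ n - 2) + 1"
proof -
  obtain m where "n = Suc (Suc m)"
    using less_imp_Suc_add[OF assms] by auto
  moreover obtain k where "(2::nat) ^ m = Suc k"
    by (metis not0_implies_Suc power_not_zero zero_neq_numeral)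
  ultimately have *: "(2::nat) ^ n = 4 * k + 4"
    by simp
  have "2 ^ n - 3 = Suc (2 * (2 * k))" "2 ^ n - 2 = 2 * Suc (2 * k)"
    "2 ^ n - 1 = Suc (2 * Suc (2 * k))"
    unfolding * by simp_all
  then show "thue_morse (2 ^ n - 3) = thue_morse (2 ^ n - 2)"
    "thue_morse (2 ^ n - 1) = thue_morse (2 ^ n - 2) + 1"
    by (simp_all only: thue_morse_double thue_morse_Suc_double)
qed

section \<open>Progressions of difference \<open>2 ^ n + 1\<close>\<close>

lemma mono_AP_exists:
  assumes "1 < n"
  shows "has_mono_AP (2 ^ n + 1) (2 ^ n + 2)"
proof -
  define N :: nat where "N = 2 ^ n"
  have N: "4 \<le> N"
    using power_increasing[of 2 n "2::nat"] assms by (simp add: N_def)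
  \<comment> \<open>This is \<open>4 * N * N - (N + 1)\<close>, with base-\<open>N\<close> digits
    \<open>3\<close>, \<open>N - 2\<close>, \<open>N - 1\<close>, so that the very first step
    carries.\<close>
  define i where "i = N * (N * 3 + (N - 2)) + (N - 1)"
  have digits: "thue_morse (N * b + a) = thue_morse b + thue_morse a" if "a < N" for a b
    using thue_morse_digits that by (simp add: N_def)
  have "thue_morse i = thue_morse 3 + thue_morse (N - 2) + thue_morse (N - 1)"
    unfolding i_def using N by (simp only: digits)
  also have "\<dots> = 1"
    using thue_morse_power_end(2)[OF assms, folded N_def]
    by (cases "thue_morse (N - 2)") (simp_all add: thue_morse_small)
  finally have first: "thue_morse i = 1" .
  have shift: "i + (N + 1) = N * (N * 4)"
  proof -
    have "2 \<le> N"
      using N by simp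
    then obtain k where "N = k + 2"
      by (metis le_add_diff_inverse2)
    then show ?thesis
      by (simp add: i_def algebra_simps)
  qed
  have "thue_morse (i + j * (N + 1)) = 1" if j: "j < N + 2" for j
  proof -
    consider "j = 0" | "0 < j" "j \<le> N" | "j = Suc N"
      using j by linarith
    then show ?thesis
    proof cases
      case 1
      then show ?thesis
        by (simp add: first)
    next
      case 2
      then obtain s where s: "j = Suc s" "s < N"
        by (cases j) auto
      \<comment> \<open>The two low digits are both \<open>s\<close>, so their letters
        cancel.\<close>
      then have "i + j * (N + 1) = N * (N * 4 + s) + s"
        using shift by (simp add: algebra_simps)
      then have "thue_morse (i + j * (N + 1)) = thue_morse 4 + thue_morse s + thue_morse s"
        by (simp only: digits[OF s(2)])
      then show ?thesis
        by (cases "thue_morse s") (simp_all add: thue_morse_small)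
    next
      case 3
      then have "i + j * (N + 1) = N * (N * 5 + 1) + 0"
        using shift by (simp add: algebra_simps)
      moreover have "0 < N" "1 < N"
        using N by simp_all
      ultimately have
        "thue_morse (i + j * (N + 1)) = thue_morse 5 + thue_morse 1 + thue_morse 0"
        by (simp only: digits)
      then show ?thesis
        by (simp add: thue_morse_small thue_morse_0)
    qed
  qed
  then show ?thesis
    using first unfolding has_mono_AP_def N_def by (metis add_gr_0 zero_less_numeral less_one)
qed

lemma no_longer_mono_AP:
  assumes "1 < n" and mono: "\<And>j. j < 2 ^ n + 3 \<Longrightarrow> thue_morse (i + j * (2 ^ n + 1)) = c"
  shows False
proof -
  define N :: nat where "N = 2 ^ n"
  have N: "4 \<le> N"
    using power_increasing[of 2 n "2::nat"] assms(1) by (simp add: N_def)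
  have digits: "thue_morse (N * b + a) = thue_morse b + thue_morse a" if "a < N" for a b
    using thue_morse_digits that by (simp add: N_def)
  note mono' = mono[folded N_def]
  define a b where "a = i mod N" and "b = i div N"
  have i: "i = N * b + a" and a: "a < N"
    using N by (simp_all add: a_def b_def)
  \<comment> \<open>\<open>l\<close> counts the terms before the first carry. The high part then
    jumps from \<open>e - 1\<close> to \<open>e + 1\<close>, skipping \<open>e\<close>.\<close>
  define l where "l = N - a"
  have l: "0 < l" "l \<le> N" "a = N - l"
    using a by (simp_all add: l_def)
  define e where "e = b + l"
  \<comment> \<open>Terms before the carry are counted backwards: \<open>r\<close> steps before it,
    the high part is \<open>e - r\<close> and the low part \<open>N - r\<close>.\<close>
  have before: "thue_morse m + thue_morse p = c"
    if "m + r = e" "p + r = N" "0 < r" "r \<le> l" for m p r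
  proof -
    obtain k where k: "l = r + k"
      using \<open>r \<le> l\<close> le_iff_add by blast
    have "m = b + k" "p = a + k"
      using that l by (simp_all add: e_def k)
    then have "i + k * (N + 1) = N * m + p"
      by (simp add: i algebra_simps)
    moreover have "k < N + 3" "p < N"
      using that l k by simp_all
    ultimately show ?thesis
      using mono' digits by metis
  qed
  have after: "thue_morse m + thue_morse s = c"
    if "m = e + 1 + s" "s < N" "l + s < N + 3" for m s
  proof -
    have "i + (l + s) * (N + 1) = N * (b + l + s) + (a + l) + s"
      by (simp add: i algebra_simps)
    also have "\<dots> = N * m + s"
      using l that(1) by (simp add: e_def algebra_simps)
    finally show ?thesis
      using mono' digits that by metis
  qed
  \<comment> \<open>A second carry comes \<open>N\<close> terms after the first; the length
    \<open>N + 3\<close> leaves only \<open>3 - l\<close> terms beyond it.\<close>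
  have after2: "thue_morse m + thue_morse s = c"
    if "m = e + N + 2 + s" "s < N" "l + s < 3" for m s
  proof -
    have "i + (l + N + s) * (N + 1) = N * (b + l + N + s) + (a + l) + N + s"
      by (simp add: i algebra_simps)
    also have "\<dots> = N * m + s"
      using l that(1) by (simp add: e_def algebra_simps)
    finally have "i + (l + N + s) * (N + 1) = N * m + s" .
    moreover have "l + N + s < N + 3"
      using that by simp
    ultimately show ?thesis
      using mono' digits that(2) by metis
  qed
  have tail: "thue_morse (N - 3) = thue_morse (N - 2)"
    "thue_morse (N - 1) = thue_morse (N - 2) + 1"
    using thue_morse_power_end[OF assms(1)] by (simp_all add: N_def)
  have "thue_morse (e + 2) + thue_morse (Suc 0) = c" "thue_morse (Suc (e + 2)) + thue_morse 2 = c"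
    by (rule after; use l N in simp)+
  then have "odd (e + 2)"
    unfolding thue_morse_small by (rule thue_morse_neighbours)
  then obtain g where g: "e = Suc (2 * g)"
    by (auto elim: oddE)
  have "l \<le> 2"
  proof (rule ccontr)
    assume "\<not> l \<le> 2"
    then have "3 \<le> e"
      by (simp add: e_def)
    then obtain h where h: "e = h + 3"
      by (metis le_add_diff_inverse2)
    have "thue_morse h + thue_morse (N - 3) = c"
      by (rule before[of _ 3]) (use \<open>\<not> l \<le> 2\<close> h N in simp_all)
    moreover have "thue_morse (Suc h) + thue_morse (N - 2) = c"
      by (rule before[of _ 2]) (use \<open>\<not> l \<le> 2\<close> h N in simp_all)
    ultimately have "odd h"
      unfolding tail(1) by (rule thue_morse_neighbours)
    with \<open>odd (e + 2)\<close> h show False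
      by simp
  qed
  \<comment> \<open>Two consecutive terms with complementary low letters are needed, the first at an
    odd high position: the last two before the first carry if \<open>l = 2\<close>, the first two
    after the second carry if \<open>l = 1\<close>.\<close>
  have "even g"
  proof (cases "l = 2")
    case True
    then have "g \<noteq> 0"
      using g by (simp add: e_def)
    then obtain h where h: "g = Suc h"
      by (cases g) auto
    have "thue_morse (Suc (2 * h)) + thue_morse (N - 2) = c"
      by (rule before[of _ 2]) (use True g h N in simp_all)
    moreover have "thue_morse (2 * Suc h) + thue_morse (N - 1) = c"
      by (rule before[of _ 1]) (use True g h N in simp_all)
    ultimately have "odd h"
      unfolding tail(2) by (rule thue_morse_neighbours_Suc_double)
    then show ?thesis
      by (simp add: h)
  next
    case False
    then have "l = 1"
      using \<open>l \<le> 2\<close> l(1) by simp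
    obtain k where k: "n = Suc (Suc k)"
      using less_imp_Suc_add[OF assms(1)] by auto
    define m where "m = Suc (g + 2 * 2 ^ k)"
    have m: "e + N + 2 = Suc (2 * m)"
      by (simp add: m_def g N_def k)
    have "thue_morse (Suc (2 * m)) + thue_morse 0 = c"
      by (rule after2) (use m \<open>l = 1\<close> N in simp_all)
    moreover have "thue_morse (2 * Suc m) + thue_morse (Suc 0) = c"
      by (rule after2) (use m \<open>l = 1\<close> N in simp_all)
    ultimately have "odd m"
      by (intro thue_morse_neighbours_Suc_double[of m 0 c])
         (simp_all only: thue_morse_0 thue_morse_small add_0)
    then show ?thesis
      by (simp add: m_def)
  qed
  \<comment> \<open>Here two even high positions at distance two carry equal low letters. Low parts
    \<open>2\<close> and \<open>4\<close> serve when \<open>4 < N\<close>; for \<open>N = 4\<close>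
    the pair straddles the skipped position \<open>e\<close>, with low parts \<open>3\<close> and
    \<open>0\<close>.\<close>
  moreover have "odd g"
  proof (cases "n = 2")
    case True
    then have "N = 4"
      by (simp add: N_def)
    have "thue_morse (2 * g) + thue_morse 3 = c"
      by (rule before[of _ 1]) (use \<open>N = 4\<close> l(1) g in simp_all)
    moreover have "thue_morse (2 * Suc g) + thue_morse 0 = c"
      by (rule after) (use \<open>N = 4\<close> l(2) g in simp_all)
    ultimately show ?thesis
      unfolding thue_morse_small thue_morse_0 by (rule thue_morse_neighbours_double)
  next
    case False
    then have "8 \<le> N"
      using power_increasing[of 3 n "2::nat"] assms(1) by (simp add: N_def)
    have "thue_morse (2 * (g + 2)) + thue_morse 2 = c"
      by (rule after) (use \<open>8 \<le> N\<close> \<open>l \<le> 2\<close> g in simp_all)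
    moreover have "thue_morse (2 * Suc (g + 2)) + thue_morse 4 = c"
      by (rule after) (use \<open>8 \<le> N\<close> \<open>l \<le> 2\<close> g in simp_all)
    ultimately have "odd (g + 2)"
      unfolding thue_morse_small by (rule thue_morse_neighbours_double)
    then show ?thesis
      by simp
  qed
  ultimately show False
    by simp
qed

theorem proposition16:
  fixes n :: nat
  assumes "n > 1"
  shows "A (2 ^ n + 1) = 2 ^ n + 2"
  unfolding A_def
proof (rule Greatest_equality)
  show "has_mono_AP (2 ^ n + 1) (2 ^ n + 2)"
    by (rule mono_AP_exists[OF assms])
next
  fix L
  assume "has_mono_AP (2 ^ n + 1) L"
  then obtain i where "\<And>j. j < L \<Longrightarrow> thue_morse (i + j * (2 ^ n + 1)) = thue_morse i"
    unfolding has_mono_AP_def by blast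
  then show "L \<le> 2 ^ n + 2"
    using no_longer_mono_AP[OF assms, of i "thue_morse i"] by fastforce
qed

end
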